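(* Let $0<\alpha<1$ be non-integer, let $a,b\in\mathbb{R}$ with $a\equiv b\ (\mathrm{mod}\ 1)$, and let $f$ be defined on $\mathbb{N}_a\cap{}_b\mathbb{N}$. Let $L:(\mathbb{N}_a\cap{}_b\mathbb{N})\times\mathbb{R}\times\mathbb{R}\to\mathbb{R}$, $(t,u,v)\mapsto L(t,u,v)$. Assume that the functional $$J(f)=\sum_{t=a+1}^{b-1}L\big(t,f^{\rho}(t),({}^{C}\nabla_a^{\alpha}f)(t)\big)$$ has a local extremum in $S=\{y:\mathbb{N}_a\cap{}_b\mathbb{N}\to\mathbb{R}\ \text{is bounded}\}$ at some $f\in S$. Put $L_1(s)=\dfrac{\partial L}{\partial u}\big(s,f^{\rho}(s),({}^{C}\nabla_a^{\alpha}f)(s)\big)$ and $L_2(s)=\dfrac{\partial L}{\partial v}\big(s,f^{\rho}(s),({}^{C}\nabla_a^{\alpha}f)(s)\big)$. Further, assume either $f(a)=A$ and $f(b-1)=B$ (with $A,B$ given real numbers), or the natural boundary conditions $({}_b\nabla^{-(1-\alpha)}L_2)(a)=({}_b\nabla^{-(1-\alpha)}L_2)(b-1)=0$. Then $$L_1^{\sigma}(s)+({}_b\nabla^{\alpha}L_2)(s)=0\qquad\text{for all } s\in\mathbb{N}_{a+1}\cap{}_{b-2}\mathbb{N}.$$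
   Context: Notation: $\mathbb{N}_a=\{a,a+1,\dots\}$, ${}_b\mathbb{N}=\{b,b-1,\dots\}$; $\rho(t)=t-1$, $\sigma(t)=t+1$, $h^{\rho}(t)=h(\rho(t))$, $h^{\sigma}(t)=h(\sigma(t))$; $\nabla h(t)=h(t)-h(t-1)$; $\Delta h(t)=h(t+1)-h(t)$. Rising function: $t^{\overline{\beta}}=\Gamma(t+\beta)/\Gamma(t)$. Empty sums are $0$. For $0<\alpha<1$, the nabla left Caputo fractional difference of order $\alpha$ starting from $a$ is $$({}^{C}\nabla_a^{\alpha}y)(t)=\frac{1}{\Gamma(1-\alpha)}\sum_{s=a+1}^{t}(t-\rho(s))^{\overline{-\alpha}}\,\nabla y(s),\qquad t\in\mathbb{N}_{a+1}.$$ The nabla right fractional sum of order $1-\alpha$ ending at $b$ is $$({}_b\nabla^{-(1-\alpha)}g)(t)=\frac{1}{\Gamma(1-\alpha)}\sum_{s=t}^{b-1}(s-\rho(t))^{\overline{-\alpha}}g(s),\qquad t\in{}_{b-1}\mathbb{N},$$ and the nabla right (Riemann) fractional difference of order $\alpha$ ending at $b$ is $({}_b\nabla^{\alpha}g)(t)=-\Delta\big({}_b\nabla^{-(1-\alpha)}g\big)(t)$ for $t\in{}_{b-1}\mathbb{N}$. The partial derivatives of $L$ in its second and third arguments are understood to exist where used. The value $L_2(a)$, which enters only the natural boundary condition at $a$, is formed with ${}^{C}\nabla_a^{\alpha}f(a)=0$ (empty sum) and an arbitrarily assigned value $f(a-1)$. "Local extremum in $S$ at $f$" (local maximum or local minimum)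 is with respect to the sup norm: there is $\epsilon>0$ such that $J(y)-J(f)\le 0$ (for a maximum), or $\ge 0$ (for a minimum), for all $y\in S$ with $\sup_{t\in\mathbb{N}_a\cap{}_b\mathbb{N}}|y(t)-f(t)|<\epsilon$. *)

theory Defs
  imports "HOL-Analysis.Analysis"
begin

definition nat_up :: "real \<Rightarrow> real set"
  where "nat_up a = {a + real n | n. True}"

definition nat_down :: "real \<Rightarrow> real set"
  where "nat_down b = {b - real n | n. True}"

text \<open>
  The set of \<open>t\<close> with \<open>t = p, p + 1, \<dots>, q\<close>. It is always finite, and it is empty if
  \<open>q < p\<close>, so that sums over it follow the convention that empty sums are \<open>0\<close>.
\<close>

definition grid :: "real \<Rightarrow> real \<Rightarrow> real set"
  where "grid p q = nat_up p \<inter> nat_down q"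

definition rho_shift :: "real \<Rightarrow> real" where "rho_shift t = t - 1"

definition sigma_shift :: "real \<Rightarrow> real" where "sigma_shift t = t + 1"

definition nabla :: "(real \<Rightarrow> real) \<Rightarrow> real \<Rightarrow> real"
  where "nabla h t = h t - h (rho_shift t)"

definition Delta :: "(real \<Rightarrow> real) \<Rightarrow> real \<Rightarrow> real"
  where "Delta h t = h (sigma_shift t) - h t"

definition rising :: "real \<Rightarrow> real \<Rightarrow> real"
  where "rising t \<beta> = Gamma (t + \<beta>) / Gamma t"

definition caputo_left :: "real \<Rightarrow> real \<Rightarrow> (real \<Rightarrow> real) \<Rightarrow> real \<Rightarrow> real"
  where "caputo_left a \<alpha> y t =
    1 / Gamma (1 - \<alpha>) * (\<Sum>s\<in>grid (a + 1) t. rising (t - rho_shift s) (- \<alpha>) * nabla y s)"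

text \<open>Right fractional sum of order \<open>\<nu>\<close> ending at \<open>b\<close>; it is used with \<open>\<nu> = 1 - \<alpha>\<close>.\<close>

definition right_frac_sum :: "real \<Rightarrow> real \<Rightarrow> (real \<Rightarrow> real) \<Rightarrow> real \<Rightarrow> real"
  where "right_frac_sum b \<nu> g t =
    1 / Gamma \<nu> * (\<Sum>s\<in>grid t (b - 1). rising (s - rho_shift t) (\<nu> - 1) * g s)"

definition right_frac_diff :: "real \<Rightarrow> real \<Rightarrow> (real \<Rightarrow> real) \<Rightarrow> real \<Rightarrow> real"
  where "right_frac_diff b \<alpha> g t = - Delta (right_frac_sum b (1 - \<alpha>) g) t"

definition functional_J ::
  "(real \<Rightarrow> real \<Rightarrow> real \<Rightarrow> real) \<Rightarrow> real \<Rightarrow> real \<Rightarrow> real \<Rightarrow> (real \<Rightarrow> real) \<Rightarrow> real"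
  where "functional_J L a b \<alpha> y =
    (\<Sum>t\<in>grid (a + 1) (b - 1). L t (y (rho_shift t)) (caputo_left a \<alpha> y t))"

text \<open>
  Functions on \<open>grid a b\<close> are represented by total functions, of which only the values on
  the grid matter for \<open>functional_J\<close>, \<open>bounded_funs\<close> and the sup distance below.
\<close>

definition bounded_funs :: "real \<Rightarrow> real \<Rightarrow> (real \<Rightarrow> real) set"
  where "bounded_funs a b = {y. bounded (y ` grid a b)}"

definition sup_dist :: "real set \<Rightarrow> (real \<Rightarrow> real) \<Rightarrow> (real \<Rightarrow> real) \<Rightarrow> real"
  where "sup_dist D y f = (SUP t\<in>D. \<bar>y t - f t\<bar>)"

definition local_max_at ::
  "((real \<Rightarrow> real) \<Rightarrow> real) \<Rightarrow> (real \<Rightarrow> real) set \<Rightarrow> real set \<Rightarrow> (real \<Rightarrow> real) \<Rightarrow> bool"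
  where "local_max_at J S D f \<longleftrightarrow>
    f \<in> S \<and> (\<exists>\<epsilon>>0. \<forall>y\<in>S. sup_dist D y f < \<epsilon> \<longrightarrow> J y - J f \<le> 0)"

definition local_min_at ::
  "((real \<Rightarrow> real) \<Rightarrow> real) \<Rightarrow> (real \<Rightarrow> real) set \<Rightarrow> real set \<Rightarrow> (real \<Rightarrow> real) \<Rightarrow> bool"
  where "local_min_at J S D f \<longleftrightarrow>
    f \<in> S \<and> (\<exists>\<epsilon>>0. \<forall>y\<in>S. sup_dist D y f < \<epsilon> \<longrightarrow> J y - J f \<ge> 0)"

definition local_extremum_at ::
  "((real \<Rightarrow> real) \<Rightarrow> real) \<Rightarrow> (real \<Rightarrow> real) set \<Rightarrow> real set \<Rightarrow> (real \<Rightarrow> real) \<Rightarrow> bool"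
  where "local_extremum_at J S D f \<longleftrightarrow> local_max_at J S D f \<or> local_min_at J S D f"

text \<open>
  Partial derivatives of \<open>L\<close> along \<open>f\<close>, with separate existence predicates because
  \<open>deriv\<close> is total. At \<open>s = a\<close> the Caputo difference is an empty sum, and \<open>f (rho_shift a)\<close> is
  the value of the total function \<open>f\<close> outside the grid, which is arbitrary.
\<close>

definition partial1 ::
  "(real \<Rightarrow> real \<Rightarrow> real \<Rightarrow> real) \<Rightarrow> real \<Rightarrow> real \<Rightarrow> (real \<Rightarrow> real) \<Rightarrow> real \<Rightarrow> real"
  where "partial1 L a \<alpha> f s = deriv (\<lambda>u. L s u (caputo_left a \<alpha> f s)) (f (rho_shift s))"

definition partial1_exists ::
  "(real \<Rightarrow> real \<Rightarrow> real \<Rightarrow> real) \<Rightarrow> real \<Rightarrow> real \<Rightarrow> (real \<Rightarrow> real) \<Rightarrow> real \<Rightarrow> bool"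
  where "partial1_exists L a \<alpha> f s \<longleftrightarrow>
    (\<lambda>u. L s u (caputo_left a \<alpha> f s)) field_differentiable at (f (rho_shift s))"

definition partial2 ::
  "(real \<Rightarrow> real \<Rightarrow> real \<Rightarrow> real) \<Rightarrow> real \<Rightarrow> real \<Rightarrow> (real \<Rightarrow> real) \<Rightarrow> real \<Rightarrow> real"
  where "partial2 L a \<alpha> f s = deriv (\<lambda>v. L s (f (rho_shift s)) v) (caputo_left a \<alpha> f s)"

definition partial2_exists ::
  "(real \<Rightarrow> real \<Rightarrow> real \<Rightarrow> real) \<Rightarrow> real \<Rightarrow> real \<Rightarrow> (real \<Rightarrow> real) \<Rightarrow> real \<Rightarrow> bool"
  where "partial2_exists L a \<alpha> f s \<longleftrightarrow>
    (\<lambda>v. L s (f (rho_shift s)) v) field_differentiable at (caputo_left a \<alpha> f s)"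

end

theory Submission
  imports Defs "HOL-Computational_Algebra.Formal_Power_Series"
begin

unbundle no vec_syntax
unbundle fps_syntax

text \<open>
  Existence of the partial derivatives of \<open>L\<close> does not give a chain rule, so a variation may
  not move both arguments of a summand at once. Such variations nevertheless suffice: the
  Caputo difference acts on sequences vanishing at \<open>a\<close> as multiplication by an invertible power
  series \<open>Z\<close>, and the variation \<open>X\<^sup>r / Z\<close> has Caputo difference \<open>X\<^sup>r\<close>. It therefore changes only
  the last argument of the summand with index \<open>r\<close>, and only the middle argument of
  the later ones. Every variation vanishing at \<open>a\<close>, in particular a unit one, is a linear
  combination of these, and the formal first variation is linear.
\<close>

subsection \<open>Grids\<close>

lemma grid_eq_image:
  "grid (a + real m) (a + real n) = (\<lambda>k. a + real k) ` {m..n}"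
proof (intro equalityI subsetI)
  fix x assume "x \<in> grid (a + real m) (a + real n)"
  then obtain i j where "x = a + real m + real i" "x = a + real n - real j"
    unfolding grid_def nat_up_def nat_down_def by blast
  then have "x = a + real (m + i)" "m + i + j = n" by linarith+
  then show "x \<in> (\<lambda>k. a + real k) ` {m..n}"
    by (intro image_eqI[of _ _ "m + i"]) auto
next
  fix x assume "x \<in> (\<lambda>k. a + real k) ` {m..n}"
  then obtain k where k: "m \<le> k" "k \<le> n" "x = a + real k" by auto
  then have "x = a + real m + real (k - m)" "x = a + real n - real (n - k)"
    by (auto simp: of_nat_diff)
  then show "x \<in> grid (a + real m) (a + real n)"
    unfolding grid_def nat_up_def nat_down_def by blast
qed

lemma sum_grid:
  "sum g (grid (a + real m) (a + real n)) = (\<Sum>k=m..n. g (a + real k))"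
  unfolding grid_eq_image by (subst sum.reindex) (auto simp: inj_on_def)

lemma sum_grid_from_1:
  "sum g (grid (a + 1) (a + real n)) = (\<Sum>k=1..n. g (a + real k))"
  using sum_grid[of g a 1 n] by simp

text \<open>A single point of the interior grid already ties \<open>b\<close> to \<open>a\<close>.
  Everything is then indexed by integer offsets from \<open>a\<close>, which serve as exponents of
  power series.\<close>

lemma grid_interior_obtain:
  assumes "s \<in> grid (a + 1) (b - 2)"
  obtains N k where "b = a + real N" "s = a + real k" "1 \<le> k" "k + 2 \<le> N"
proof -
  obtain i j where "s = a + 1 + real i" "s = b - 2 - real j"
    using assms unfolding grid_def nat_up_def nat_down_def by blast
  then have "b = a + real (i + j + 3)" "s = a + real (i + 1)" by auto
  then show ?thesis by (rule that) auto
qed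

subsection \<open>Fractional operators as power series\<close>

text \<open>This is the binomial series of \<open>(1 - X) powr (\<alpha> - 1)\<close>, so that
  \<open>kernel \<alpha> * (1 - fps_X)\<close> plays the role of
  \<open>(1 - X) powr \<alpha>\<close>.\<close>

definition kernel :: "real \<Rightarrow> real fps"
  where "kernel \<alpha> = Abs_fps (\<lambda>n. rising (real n + 1) (- \<alpha>) / Gamma (1 - \<alpha>))"

lemma kernel_nth_0:
  assumes "\<alpha> < 1"
  shows "kernel \<alpha> $ 0 = 1"
proof -
  have "0 < Gamma (1 - \<alpha>)" using assms by (intro Gamma_real_pos) simp
  then show ?thesis by (simp add: kernel_def rising_def)
qed

lemma caputo_left_eq:
  "caputo_left a \<alpha> y (a + real n) =
    (\<Sum>k=1..n. kernel \<alpha> $ (n - k) * (y (a + real k) - y (a + real (k - 1))))"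
proof -
  have "caputo_left a \<alpha> y (a + real n) = 1 / Gamma (1 - \<alpha>) *
      (\<Sum>k=1..n. rising (a + real n - rho_shift (a + real k)) (- \<alpha>) * nabla y (a + real k))"
    unfolding caputo_left_def sum_grid_from_1 ..
  also have "\<dots> = (\<Sum>k=1..n. kernel \<alpha> $ (n - k) * (y (a + real k) - y (a + real (k - 1))))"
    unfolding sum_distrib_left
    by (intro sum.cong) (auto simp: kernel_def nabla_def rho_shift_def diff_divide_distrib algebra_simps)
  finally show ?thesis .
qed

lemma caputo_left_add_scaled:
  "caputo_left a \<alpha> (\<lambda>t. f t + h * g t) t = caputo_left a \<alpha> f t + h * caputo_left a \<alpha> g t"
proof -
  have "nabla (\<lambda>t. f t + h * g t) s = nabla f s + h * nabla g s" for s
    by (simp add: nabla_def algebra_simps)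
  then show ?thesis
    by (simp add: caputo_left_def distrib_left sum.distrib sum_distrib_left ac_simps)
qed

text \<open>The nabla difference is multiplication by \<open>1 - fps_X\<close>, and the fractional
  sum is convolution with the kernel. The Caputo sum starts at 1 while the Cauchy product starts at
  0; the vanishing constant term of \<open>\<xi>\<close> removes the discrepancy.\<close>

lemma caputo_left_fps:
  assumes "\<And>k. y (a + real k) = \<xi> $ k" and "\<xi> $ 0 = 0"
  shows "caputo_left a \<alpha> y (a + real n) = (kernel \<alpha> * (1 - fps_X) * \<xi>) $ n"
proof -
  have "(kernel \<alpha> * (1 - fps_X) * \<xi>) $ n = ((\<xi> - fps_X * \<xi>) * kernel \<alpha>) $ n"
    by (simp add: algebra_simps)
  also have "\<dots> = (\<Sum>k=0..n. (\<xi> $ k - (if k = 0 then 0 else \<xi> $ (k - 1))) * kernel \<alpha> $ (n - k))"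
    unfolding fps_mult_nth[of "\<xi> - fps_X * \<xi>"] by simp
  also have "\<dots> = (\<Sum>k=1..n. (\<xi> $ k - (if k = 0 then 0 else \<xi> $ (k - 1))) * kernel \<alpha> $ (n - k))"
    using assms(2) by (simp add: sum.atLeast_Suc_atMost)
  also have "\<dots> = caputo_left a \<alpha> y (a + real n)"
    unfolding caputo_left_eq by (intro sum.cong) (auto simp: assms(1) simp del: of_nat_diff)
  finally show ?thesis by simp
qed

lemma right_frac_sum_eq:
  assumes "b = a + real (Suc M)"
  shows "right_frac_sum b (1 - \<alpha>) g (a + real k) =
    (\<Sum>n=k..M. kernel \<alpha> $ (n - k) * g (a + real n))"
proof -
  have b: "b - 1 = a + real M" using assms by simp
  have "right_frac_sum b (1 - \<alpha>) g (a + real k) = 1 / Gamma (1 - \<alpha>) *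
      (\<Sum>n=k..M. rising (a + real n - rho_shift (a + real k)) (- \<alpha>) * g (a + real n))"
    unfolding right_frac_sum_def b sum_grid by simp
  also have "\<dots> = (\<Sum>n=k..M. kernel \<alpha> $ (n - k) * g (a + real n))"
    unfolding sum_distrib_left
    by (intro sum.cong) (auto simp: kernel_def rho_shift_def of_nat_diff algebra_simps)
  finally show ?thesis .
qed

text \<open>Summation by parts: the right difference is the transpose of the left Caputo operator.
  It pairs \<open>g\<close> with the Caputo difference of the unit variation at
  \<open>a + real k\<close>, whose series is \<open>fps_X ^ k\<close>.\<close>

lemma right_frac_diff_eq:
  assumes "b = a + real (Suc M)" and "1 \<le> k"
  shows "right_frac_diff b \<alpha> g (a + real k) =
    (\<Sum>n=1..M. g (a + real n) * (kernel \<alpha> * (1 - fps_X) * fps_X ^ k) $ n)"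
proof -
  have Z: "kernel \<alpha> * (1 - fps_X) * fps_X ^ k =
      fps_X ^ k * kernel \<alpha> - fps_X ^ Suc k * kernel \<alpha>"
    by (simp add: algebra_simps)
  \<comment> \<open>The factor \<open>fps_X ^ j\<close> kills all coefficients below
    \<open>j\<close>; since \<open>1 \<le> j\<close>, starting the sum at 1 loses nothing.\<close>
  have tail: "(\<Sum>n=1..M. g (a + real n) * (fps_X ^ j * kernel \<alpha>) $ n) =
      right_frac_sum b (1 - \<alpha>) g (a + real j)" if "1 \<le> j" for j
  proof -
    have "(\<Sum>n=1..M. g (a + real n) * (fps_X ^ j * kernel \<alpha>) $ n) =
        (\<Sum>n=j..M. g (a + real n) * (fps_X ^ j * kernel \<alpha>) $ n)"
      using that by (intro sum.mono_neutral_right) (auto simp: fps_X_power_mult_nth)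
    also have "\<dots> = right_frac_sum b (1 - \<alpha>) g (a + real j)"
      unfolding right_frac_sum_eq[OF assms(1)]
      by (intro sum.cong) (auto simp: fps_X_power_mult_nth)
    finally show ?thesis .
  qed
  have "sigma_shift (a + real k) = a + real (Suc k)" by (simp add: sigma_shift_def)
  then have "right_frac_diff b \<alpha> g (a + real k) =
      right_frac_sum b (1 - \<alpha>) g (a + real k) - right_frac_sum b (1 - \<alpha>) g (a + real (Suc k))"
    by (simp only: right_frac_diff_def Delta_def minus_diff_eq)
  also have "\<dots> = (\<Sum>n=1..M. g (a + real n) * (kernel \<alpha> * (1 - fps_X) * fps_X ^ k) $ n)"
    using tail[OF assms(2)] tail[of "Suc k"]
    unfolding Z by (simp add: right_diff_distrib sum_subtractf del: power_Suc of_nat_Suc)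
  finally show ?thesis .
qed

text \<open>Expanding \<open>Z * \<xi>\<close> in powers of \<open>fps_X\<close> and dividing by
  \<open>Z\<close> writes \<open>\<xi>\<close>, up to index \<open>M\<close>, as a combination of
  the series in \<open>basis\<close>. The power \<open>r = 0\<close> does not occur because
  \<open>\<xi> $ 0 = 0\<close>.\<close>

lemma fps_functional_eq_0:
  fixes Z \<xi> :: "'a::field fps"
  assumes Z: "Z $ 0 \<noteq> 0" and \<xi>: "\<xi> $ 0 = 0"
    and basis: "\<And>r. 1 \<le> r \<Longrightarrow> r \<le> M \<Longrightarrow>
      (\<Sum>n=1..M. p n * (fps_X ^ r * inverse Z) $ (n - 1) + q n * (fps_X ^ r) $ n) = 0"
  shows "(\<Sum>n=1..M. p n * \<xi> $ (n - 1) + q n * (Z * \<xi>) $ n) = 0"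
proof -
  define c where "c = Z * \<xi>"
  have c0: "c $ 0 = 0" by (simp add: c_def \<xi>)
  have "\<xi> = c * inverse Z"
    using inverse_mult_eq_1'[OF Z] by (simp add: c_def algebra_simps)
  have \<xi>_nth: "\<xi> $ m = (\<Sum>r=1..M. c $ r * (fps_X ^ r * inverse Z) $ m)" if "m \<le> M" for m
  proof -
    have "\<xi> $ m = (\<Sum>r=0..m. c $ r * inverse Z $ (m - r))"
      by (subst \<open>\<xi> = c * inverse Z\<close>) (rule fps_mult_nth)
    also have "\<dots> = (\<Sum>r=0..m. c $ r * (fps_X ^ r * inverse Z) $ m)"
      by (intro sum.cong) (auto simp: fps_X_power_mult_nth)
    \<comment> \<open>The added terms with \<open>r > m\<close> vanish. A range of \<open>r\<close>
      independent of \<open>m\<close> allows the sums over \<open>n\<close> and \<open>r\<close> to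
      be swapped below.\<close>
    also have "\<dots> = (\<Sum>r=0..M. c $ r * (fps_X ^ r * inverse Z) $ m)"
      using that by (intro sum.mono_neutral_left) (auto simp: fps_X_power_mult_nth)
    also have "\<dots> = (\<Sum>r=1..M. c $ r * (fps_X ^ r * inverse Z) $ m)"
      using c0 by (simp add: sum.atLeast_Suc_atMost)
    finally show ?thesis .
  qed
  have c_nth: "c $ n = (\<Sum>r=1..M. c $ r * (fps_X ^ r) $ n)" if "1 \<le> n" "n \<le> M" for n
    using that by (simp add: fps_X_power_nth if_distrib sum.delta cong: if_cong)
  have "(\<Sum>n=1..M. p n * \<xi> $ (n - 1) + q n * c $ n) =
      (\<Sum>n=1..M. \<Sum>r=1..M. c $ r *
        (p n * (fps_X ^ r * inverse Z) $ (n - 1) + q n * (fps_X ^ r) $ n))"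
  proof (intro sum.cong refl)
    fix n assume n: "n \<in> {1..M}"
    then have le: "n - 1 \<le> M" "1 \<le> n" "n \<le> M" by auto
    have "p n * \<xi> $ (n - 1) + q n * c $ n =
        p n * (\<Sum>r=1..M. c $ r * (fps_X ^ r * inverse Z) $ (n - 1)) +
        q n * (\<Sum>r=1..M. c $ r * (fps_X ^ r) $ n)"
      by (simp only: \<xi>_nth[OF le(1)] c_nth[OF le(2,3), symmetric])
    then show "p n * \<xi> $ (n - 1) + q n * c $ n = (\<Sum>r=1..M. c $ r *
        (p n * (fps_X ^ r * inverse Z) $ (n - 1) + q n * (fps_X ^ r) $ n))"
      by (simp add: sum_distrib_left sum.distrib algebra_simps del: fps_X_power_nth)
  qed
  also have "\<dots> = (\<Sum>r=1..M. c $ r *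
      (\<Sum>n=1..M. p n * (fps_X ^ r * inverse Z) $ (n - 1) + q n * (fps_X ^ r) $ n))"
    by (subst sum.swap) (simp only: sum_distrib_left)
  also have "\<dots> = 0" using basis by (intro sum.neutral) auto
  finally show ?thesis by (simp add: c_def)
qed

subsection \<open>First variation\<close>

text \<open>On a finite domain a short piece of the line through \<open>f\<close> in direction
  \<open>g\<close> stays inside any sup-norm ball, so Fermat's criterion in \<open>h\<close>
  applies.\<close>

lemma local_extremum_derivative_eq_0:
  assumes ext: "local_extremum_at J S D f"
    and D: "finite D" "D \<noteq> {}"
    and S: "\<And>h. (\<lambda>t. f t + h * g t) \<in> S"
    and deriv: "((\<lambda>h. J (\<lambda>t. f t + h * g t)) has_real_derivative l) (at 0)"
  shows "l = 0"
proof -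
  \<comment> \<open>The sum bounds \<open>g\<close> on \<open>D\<close>; the added 1 keeps
    \<open>\<epsilon> / m\<close> meaningful when \<open>g\<close> vanishes there.\<close>
  define m where "m = 1 + (\<Sum>t\<in>D. \<bar>g t\<bar>)"
  have m: "m > 0" unfolding m_def by (smt (verit) sum_nonneg abs_ge_zero)
  have bound: "\<bar>g t\<bar> \<le> m" if "t \<in> D" for t
    using member_le_sum[of t D "\<lambda>t. \<bar>g t\<bar>"] that D(1) by (simp add: m_def)
  have close: "sup_dist D (\<lambda>t. f t + h * g t) f < \<epsilon>" if "\<bar>0 - h\<bar> < \<epsilon> / m" for h \<epsilon>
  proof -
    have "sup_dist D (\<lambda>t. f t + h * g t) f \<le> \<bar>h\<bar> * m"
      unfolding sup_dist_def using D(2) bound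
      by (intro cSUP_least) (auto simp: abs_mult intro: mult_left_mono)
    also have "\<dots> < \<epsilon>" using that m by (simp add: pos_less_divide_eq)
    finally show ?thesis .
  qed
  consider "local_max_at J S D f" | "local_min_at J S D f"
    using ext unfolding local_extremum_at_def by auto
  then show ?thesis
  proof cases
    case 1
    then obtain \<epsilon> where "\<epsilon> > 0" "\<And>y. y \<in> S \<Longrightarrow> sup_dist D y f < \<epsilon> \<Longrightarrow> J y - J f \<le> 0"
      unfolding local_max_at_def by auto
    then show ?thesis
      using S close m by (intro DERIV_local_max[OF deriv, of "\<epsilon> / m"]) fastforce+
  next
    case 2
    then obtain \<epsilon> where "\<epsilon> > 0" "\<And>y. y \<in> S \<Longrightarrow> sup_dist D y f < \<epsilon> \<Longrightarrow> J y - J f \<ge> 0"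
      unfolding local_min_at_def by auto
    then show ?thesis
      using S close m by (intro DERIV_local_min[OF deriv, of "\<epsilon> / m"]) fastforce+
  qed
qed

text \<open>Motion parallel to a coordinate axis needs only the one-variable chain rule. The
  coefficient of the zero component is arbitrary, which keeps one formula for all summands.\<close>

lemma has_derivative_along_axis:
  fixes F :: "real \<Rightarrow> real \<Rightarrow> real"
  assumes "x = 0 \<and> ((\<lambda>v. F u0 v) has_real_derivative q) (at v0) \<or>
      y = 0 \<and> ((\<lambda>u. F u v0) has_real_derivative p) (at u0)"
  shows "((\<lambda>h. F (u0 + h * x) (v0 + h * y)) has_real_derivative (p * x + q * y)) (at 0)"
  using assms
proof (elim disjE conjE)
  assume "x = 0" and q: "((\<lambda>v. F u0 v) has_real_derivative q) (at v0)"
  have "((\<lambda>h. v0 + h * y) has_real_derivative y) (at 0)"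
    by (auto intro!: derivative_eq_intros)
  from DERIV_chain2[OF _ this, of "F u0" q] q \<open>x = 0\<close> show ?thesis by simp
next
  assume "y = 0" and p: "((\<lambda>u. F u v0) has_real_derivative p) (at u0)"
  have "((\<lambda>h. u0 + h * x) has_real_derivative x) (at 0)"
    by (auto intro!: derivative_eq_intros)
  from DERIV_chain2[OF _ this, of "\<lambda>u. F u v0" p] p \<open>y = 0\<close> show ?thesis by simp
qed

section \<open>The Euler-Lagrange equation\<close>

theorem theorem3p3:
  fixes \<alpha> a b A B :: real
    and f :: "real \<Rightarrow> real"
    and L :: "real \<Rightarrow> real \<Rightarrow> real \<Rightarrow> real"
  assumes alpha: "0 < \<alpha>" "\<alpha> < 1"
    and congruent: "b - a \<in> \<int>"
    and partial1_ex: "\<And>s. s \<in> grid (a + 2) (b - 1) \<Longrightarrow> partial1_exists L a \<alpha> f s"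
    and partial2_ex: "\<And>s. s \<in> grid (a + 1) (b - 1) \<Longrightarrow> partial2_exists L a \<alpha> f s"
    and extremum: "local_extremum_at (functional_J L a b \<alpha>) (bounded_funs a b) (grid a b) f"
    and boundary: "(f a = A \<and> f (b - 1) = B) \<or>
      (partial2_exists L a \<alpha> f a \<and>
       right_frac_sum b (1 - \<alpha>) (partial2 L a \<alpha> f) a = 0 \<and>
       right_frac_sum b (1 - \<alpha>) (partial2 L a \<alpha> f) (b - 1) = 0)"
  shows "\<forall>s\<in>grid (a + 1) (b - 2).
    partial1 L a \<alpha> f (sigma_shift s) + right_frac_diff b \<alpha> (partial2 L a \<alpha> f) s = 0"
proof
  fix s assume "s \<in> grid (a + 1) (b - 2)"
  then obtain N k where "b = a + real N" and s: "s = a + real k" and k: "1 \<le> k" "k + 2 \<le> N"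
    by (rule grid_interior_obtain)
  moreover obtain M where "N = Suc M" using k(2) by (cases N) auto
  ultimately have b: "b = a + real (Suc M)" and kM: "k < M" by auto
  define Z where "Z = kernel \<alpha> * (1 - fps_X)"
  define p where "p n = partial1 L a \<alpha> f (a + real n)" for n
  define q where "q n = partial2 L a \<alpha> f (a + real n)" for n
  have b_minus_1: "b - 1 = a + real M" using b by simp
  have Z0: "Z $ 0 \<noteq> 0" by (simp add: Z_def kernel_nth_0 alpha)
  have rho: "rho_shift (a + real n) = a + real (n - 1)" if "1 \<le> n" for n
    using that by (simp add: rho_shift_def of_nat_diff)
  have grid_ab: "grid a b = (\<lambda>k. a + real k) ` {0..Suc M}"
    using grid_eq_image[of a 0 "Suc M"] b by simp
  \<comment> \<open>For \<open>n = 1\<close> the middle argument is \<open>f a\<close>, which the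
    variations below leave fixed; \<open>p 1\<close> only ever gets the factor 0.\<close>
  have p: "((\<lambda>u. L (a + real n) u (caputo_left a \<alpha> f (a + real n))) has_real_derivative p n)
      (at (f (a + real (n - 1))))" if "2 \<le> n" "n \<le> M" for n
  proof -
    have "a + real n \<in> grid (a + 2) (b - 1)"
      using grid_eq_image[of a 2 M] that b by simp
    from partial1_ex[OF this] show ?thesis
      using rho[of n] that
      by (simp add: p_def partial1_def partial1_exists_def field_differentiable_derivI)
  qed
  have q: "((\<lambda>v. L (a + real n) (f (a + real (n - 1))) v) has_real_derivative q n)
      (at (caputo_left a \<alpha> f (a + real n)))" if "1 \<le> n" "n \<le> M" for n
  proof -
    have "a + real n \<in> grid (a + 1) (b - 1)"
      using grid_eq_image[of a 1 M] that b by simp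
    from partial2_ex[OF this] show ?thesis
      using rho[of n] that
      by (simp add: q_def partial2_def partial2_exists_def field_differentiable_derivI)
  qed
  have basis: "(\<Sum>n=1..M. p n * (fps_X ^ r * inverse Z) $ (n - 1) + q n * (fps_X ^ r) $ n) = 0"
    if r: "1 \<le> r" "r \<le> M" for r
  proof -
    define \<xi> where "\<xi> = fps_X ^ r * inverse Z"
    \<comment> \<open>The floor extends the coefficient sequence to a total function; only the
      values at \<open>a + real m\<close> matter.\<close>
    define g where "g t = \<xi> $ nat \<lfloor>t - a\<rfloor>" for t
    have \<xi>_below: "\<xi> $ m = 0" if "m < r" for m
      using that by (simp add: \<xi>_def fps_X_power_mult_nth)
    have g: "g (a + real m) = \<xi> $ m" for m by (simp add: g_def)
    have "kernel \<alpha> * (1 - fps_X) * \<xi> = fps_X ^ r"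
      using inverse_mult_eq_1'[OF Z0] by (simp add: \<xi>_def Z_def[symmetric] mult.left_commute)
    then have cap_g: "caputo_left a \<alpha> g (a + real n) = (fps_X ^ r) $ n" for n
      using caputo_left_fps[of g a \<xi>] g \<xi>_below r by simp
    have J: "functional_J L a b \<alpha> (\<lambda>t. f t + h * g t) =
        (\<Sum>n=1..M. L (a + real n) (f (a + real (n - 1)) + h * \<xi> $ (n - 1))
          (caputo_left a \<alpha> f (a + real n) + h * (fps_X ^ r) $ n))" for h
    proof -
      have "functional_J L a b \<alpha> (\<lambda>t. f t + h * g t) = (\<Sum>n=1..M. L (a + real n)
          (f (rho_shift (a + real n)) + h * g (rho_shift (a + real n)))
          (caputo_left a \<alpha> (\<lambda>t. f t + h * g t) (a + real n)))"
        unfolding functional_J_def b_minus_1 sum_grid_from_1 ..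
      also have "\<dots> = (\<Sum>n=1..M. L (a + real n) (f (a + real (n - 1)) + h * \<xi> $ (n - 1))
          (caputo_left a \<alpha> f (a + real n) + h * (fps_X ^ r) $ n))"
        unfolding caputo_left_add_scaled cap_g by (intro sum.cong) (auto simp: rho g simp del: of_nat_diff)
      finally show ?thesis .
    qed
    have term_deriv: "((\<lambda>h. L (a + real n) (f (a + real (n - 1)) + h * \<xi> $ (n - 1))
        (caputo_left a \<alpha> f (a + real n) + h * (fps_X ^ r) $ n)) has_real_derivative
        (p n * \<xi> $ (n - 1) + q n * (fps_X ^ r) $ n)) (at 0)" if n: "n \<in> {1..M}" for n
    proof (rule has_derivative_along_axis)
      show "\<xi> $ (n - 1) = 0 \<and> ((\<lambda>v. L (a + real n) (f (a + real (n - 1))) v)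
            has_real_derivative q n) (at (caputo_left a \<alpha> f (a + real n))) \<or>
          (fps_X ^ r) $ n = (0::real) \<and>
          ((\<lambda>u. L (a + real n) u (caputo_left a \<alpha> f (a + real n))) has_real_derivative p n)
            (at (f (a + real (n - 1))))"
      \<comment> \<open>For \<open>n \<le> r\<close> the shifted index \<open>n - 1\<close> lies
        below \<open>r\<close>, so \<open>\<xi>\<close> vanishes there. For \<open>n > r\<close> the
        Caputo difference vanishes, and \<open>n \<ge> 2\<close> makes \<open>p\<close>
        available.\<close>
      proof (cases "n \<le> r")
        case True
        then show ?thesis using q[of n] \<xi>_below[of "n - 1"] n r by auto
      next
        case False
        then show ?thesis using p[of n] n r by (auto simp: fps_X_power_nth)
      qed
    qed
    have "((\<lambda>h. functional_J L a b \<alpha> (\<lambda>t. f t + h * g t)) has_real_derivative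
        (\<Sum>n=1..M. p n * \<xi> $ (n - 1) + q n * (fps_X ^ r) $ n)) (at 0)"
      unfolding J by (intro DERIV_sum term_deriv)
    moreover have "(\<lambda>t. f t + h * g t) \<in> bounded_funs a b" for h
      by (simp add: bounded_funs_def grid_ab finite_imp_bounded)
    ultimately show ?thesis
      unfolding \<xi>_def[symmetric]
      by (intro local_extremum_derivative_eq_0[OF extremum]) (auto simp: grid_ab)
  qed
  \<comment> \<open>Here \<open>\<xi>\<close> is \<open>fps_X ^ k\<close>, the unit variation at
    \<open>s\<close>; its constant term is 0 because \<open>1 \<le> k\<close>.\<close>
  have "(\<Sum>n=1..M. p n * (fps_X ^ k) $ (n - 1) + q n * (Z * fps_X ^ k) $ n) = 0"
    by (rule fps_functional_eq_0[OF Z0 _ basis]) (use k in \<open>auto simp: fps_X_power_nth\<close>)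
  \<comment> \<open>The shift by \<open>rho_shift\<close> in the functional moves the index to
    \<open>Suc k\<close>, which is in range by \<open>k < M\<close>; this is the source of
    \<open>sigma_shift\<close> in the equation.\<close>
  moreover have "(\<Sum>n=1..M. p n * (fps_X ^ k) $ (n - 1)) = p (Suc k)"
  proof -
    have "(\<Sum>n=1..M. p n * (fps_X ^ k) $ (n - 1)) = (\<Sum>n=1..M. if n = Suc k then p n else 0)"
      by (intro sum.cong) (auto simp: fps_X_power_nth)
    then show ?thesis using kM by simp
  qed
  moreover have "sigma_shift s = a + real (Suc k)" by (simp add: s sigma_shift_def)
  ultimately show "partial1 L a \<alpha> f (sigma_shift s) +
      right_frac_diff b \<alpha> (partial2 L a \<alpha> f) s = 0"
    using right_frac_diff_eq[OF b k(1), of \<alpha> "partial2 L a \<alpha> f"]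
    by (simp add: s p_def q_def Z_def sum.distrib)
qed

end
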